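(* Let $\beta>1$ be a quadratic unit, $m\in\mathbb{N}$, $m\geq\lfloor\beta\rfloor$, and set $$\Omega=\Big(-\frac{m\beta}{\beta^2-1},\frac{m\beta^2}{\beta^2-1}\Big)\ \text{ if } \beta^2=p\beta+1 \text{ with } p\ge 1,\qquad \Omega=\Big[0,\frac{m\beta}{\beta-1}\Big)\ \text{ if } \beta^2=p\beta-1 \text{ with } p\geq 3.$$ Then there exist infinitely many $y>0$ such that $y\in\Sigma_\beta(\Omega)$ and $y\notin X^m(\beta)$, unless $m=\lfloor\beta\rfloor$ and $\beta^2=p\beta+1$ for some integer $p\geq 1$.
   Context: A quadratic unit $\beta>1$ is the larger root of $x^2-px-1$ with an integer $p\geq 1$, or of $x^2-px+1$ with an integer $p\geq 3$. For $x=a+b\beta\in\mathbb{Z}[\beta]=\mathbb{Z}+\mathbb{Z}\beta$, its Galois conjugate is $x'=a+b\beta'$, where $\beta'$ is the other root of the minimal polynomial of $\beta$. For a bounded interval $\Omega$, $\Sigma_\beta(\Omega)=\{x\in\mathbb{Z}[\beta] : x'\in\Omega\}$. The spectrum is $$X^{m}(\beta) = \Big\{\sum_{j=0}^n a_j \beta^j : n\in\mathbb{N},\ a_j\in\{0,1,\dots,m\}\Big\},\qquad \mathbb{N}=\{0,1,2,\dots\}.$$ *)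

theory Defs
  imports Complex_Main "HOL-Computational_Algebra.Polynomial"
begin

definition is_larger_root :: "int poly \<Rightarrow> real \<Rightarrow> bool" where
  "is_larger_root f \<beta> \<longleftrightarrow>
     poly (map_poly of_int f) \<beta> = 0 \<and> (\<forall>y. poly (map_poly of_int f) y = 0 \<longrightarrow> y \<le> \<beta>)"

definition quadratic_unit :: "real \<Rightarrow> bool" where
  "quadratic_unit \<beta> \<longleftrightarrow> 1 < \<beta> \<and>
     ((\<exists>p\<ge>1. is_larger_root [:-1, -p, 1:] \<beta>) \<or> (\<exists>p\<ge>3. is_larger_root [:1, -p, 1:] \<beta>))"

definition is_min_poly :: "rat poly \<Rightarrow> real \<Rightarrow> bool" where
  "is_min_poly f \<alpha> \<longleftrightarrow> lead_coeff f = 1 \<and> poly (map_poly of_rat f) \<alpha> = 0 \<and>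
     (\<forall>g. g \<noteq> 0 \<and> poly (map_poly of_rat g) \<alpha> = 0 \<longrightarrow> degree f \<le> degree g)"

(* Meaningful only if the minimal polynomial of \<beta> has exactly one further real root, as it
   does for a quadratic unit. *)
definition conj_root :: "real \<Rightarrow> real" where
  "conj_root \<beta> = (THE y. y \<noteq> \<beta> \<and> (\<exists>f. is_min_poly f \<beta> \<and> poly (map_poly of_rat f) y = 0))"

definition Z_adjoin :: "real \<Rightarrow> real set" where
  "Z_adjoin \<beta> = {of_int a + of_int b * \<beta> | a b. True}"

(* The representation x = a + b \<beta> is unique for irrational \<beta>; for x outside Z_adjoin \<beta>
   the value is unspecified. *)
definition galois_conj :: "real \<Rightarrow> real \<Rightarrow> real" where
  "galois_conj \<beta> x =
     (THE z. \<exists>a b. x = of_int a + of_int b * \<beta> \<and> z = of_int a + of_int b * conj_root \<beta>)"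

definition cut_and_project :: "real \<Rightarrow> real set \<Rightarrow> real set" where
  "cut_and_project \<beta> \<Omega> = {x \<in> Z_adjoin \<beta>. galois_conj \<beta> x \<in> \<Omega>}"

definition digit_spectrum :: "nat \<Rightarrow> real \<Rightarrow> real set" where
  "digit_spectrum m \<beta> = {\<Sum>j\<le>n. of_nat (a j) * \<beta> ^ j | n (a :: nat \<Rightarrow> nat). \<forall>j\<le>n. a j \<le> m}"

end

theory Submission
  imports Defs
begin

text \<open>
  The points are found next to the right endpoint of \<open>\<Omega>\<close>. Let \<open>d = 2\<close> and \<open>\<beta>' = - 1 / \<beta>\<close> in the
  first family, \<open>d = 1\<close> and \<open>\<beta>' = 1 / \<beta>\<close> in the second, and put \<open>r = \<beta>\<^sup>d\<close>, \<open>s = m / (r - 1)\<close>.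
  In both families \<open>\<beta>'\<^sup>j\<close> equals \<open>1 / \<beta>\<^sup>j\<close> when \<open>d\<close> divides \<open>j\<close> and is negative otherwise, so
  the largest conjugates come from the digits \<open>m\<close> at all multiples of \<open>d\<close> and \<open>0\<close> elsewhere, and
  the right endpoint of \<open>\<Omega>\<close> is the value \<open>m \<Sum>\<^sub>i r\<^sup>-\<^sup>i = s + m\<close> of this infinite expansion.

  A finite expansion whose conjugate reaches \<open>s + m - r\<^sup>-\<^sup>n\<close> cannot afford to lose \<open>r\<^sup>-\<^sup>i\<close> at any
  \<open>i \<le> n\<close>: its digits at \<open>0, d, \<dots>, n d\<close> are all \<open>m\<close> (\<open>forced_digits\<close>). Hence its value is at
  least \<open>S\<^sub>n = m \<Sum>\<^sub>i\<^sub>\<le>\<^sub>n r\<^sup>i\<close> (\<open>digit_spectrum_ge\<close>). So it suffices to find positive elements of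
  \<open>\<int>[\<beta>]\<close> below \<open>S\<^sub>n\<close> with conjugate that close to the endpoint. Take \<open>y\<^sub>n = S\<^sub>n + r\<^sup>n v\<close> for one
  fixed \<open>v\<close>: since \<open>S\<^sub>n = r\<^sup>n (s + m) - s\<close> and \<open>S\<^sub>n' = (s + m) - r\<^sup>-\<^sup>n s\<close>, the requirements become
  \<open>-(s + m) < v < 0\<close> and \<open>s - 1 \<le> v' < s\<close>, independent of \<open>n\<close>, and then every large \<open>n\<close> works.

  Such a \<open>v = a - k \<beta>\<close> exists as soon as \<open>1 + (\<beta> - \<beta>') < 2 s + m\<close> (\<open>small_point_exists\<close>): each
  \<open>k\<close> has exactly one \<open>a\<close> that places \<open>v'\<close>, and \<open>v\<close> then lies \<open>k (\<beta> - \<beta>')\<close> below \<open>v'\<close>. The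
  inequality holds for every \<open>m \<ge> \<lfloor>\<beta>\<rfloor>\<close> in the second family and for \<open>m > \<lfloor>\<beta>\<rfloor>\<close> in the first,
  but fails for \<open>m = \<lfloor>\<beta>\<rfloor>\<close> in the first, where \<open>s = 1 / \<beta>\<close>.
\<close>

section \<open>Galois conjugation in a quadratic order\<close>

text \<open>Trace and norm describe both families at once: \<open>e = - 1\<close> gives \<open>\<beta>\<^sup>2 = p \<beta> + 1\<close> and \<open>e = 1\<close>
  gives \<open>\<beta>\<^sup>2 = p \<beta> - 1\<close>.\<close>

locale conjugate_units =
  fixes \<beta> \<gamma> :: real and p e :: int
  assumes gt_1: "1 < \<beta>"
    and trace: "\<beta> + \<gamma> = of_int p"
    and norm: "\<beta> * \<gamma> = of_int e"
    and unit_norm: "\<bar>e\<bar> = 1"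
begin

lemma gamma_eq: "\<gamma> = of_int p - \<beta>"
  using trace by simp

lemma square_beta: "\<beta>\<^sup>2 = of_int p * \<beta> - of_int e"
  using norm unfolding gamma_eq by (simp add: algebra_simps power2_eq_square)

lemma square_gamma: "\<gamma>\<^sup>2 = of_int p * \<gamma> - of_int e"
  unfolding trace[symmetric] norm[symmetric] by (simp add: algebra_simps power2_eq_square)

lemma abs_gamma: "\<bar>\<gamma>\<bar> < 1"
proof -
  have "\<beta> * \<bar>\<gamma>\<bar> = \<bar>\<beta> * \<gamma>\<bar>"
    using gt_1 by (simp add: abs_mult)
  also have "\<dots> = of_int \<bar>e\<bar>"
    by (simp add: norm)
  finally have "\<bar>\<gamma>\<bar> = 1 / \<beta>"
    using gt_1 unit_norm by (simp add: field_simps)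
  then show ?thesis
    using gt_1 by simp
qed

lemma beta_not_int: "\<beta> \<notin> \<int>"
proof
  assume "\<beta> \<in> \<int>"
  then obtain n where n: "\<beta> = of_int n" by (elim Ints_cases)
  have "of_int (n * (p - n)) = (of_int e :: real)"
    using norm unfolding gamma_eq n by simp
  then have "n * (p - n) = e"
    by (simp only: of_int_eq_iff)
  then have "n dvd 1"
    using unit_norm by (metis dvd_abs_iff dvd_triv_left)
  then show False
    using gt_1 n by auto
qed

text \<open>A rational algebraic integer is an integer, and an integral \<open>\<beta>\<close> would be a divisor of the
  norm \<open>e = \<plusminus> 1\<close>.\<close>

lemma beta_irrational: "\<beta> \<notin> \<rat>"
proof -
  have "poly (map_poly of_int [:e, - p, 1:]) \<beta> = 0"
    using square_beta by (simp add: map_poly_pCons algebra_simps power2_eq_square)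
  then have "algebraic_int \<beta>"
    unfolding algebraic_int_altdef_ipoly by (intro exI[of _ "[:e, - p, 1:]"]) simp
  then show ?thesis
    using rational_algebraic_int_is_int beta_not_int by blast
qed

lemma affine_zero:
  fixes a b :: real
  assumes "a \<in> \<rat>" "b \<in> \<rat>" "a + b * \<beta> = 0"
  shows "b = 0" "a = 0"
proof -
  show "b = 0"
  proof (rule ccontr)
    assume "b \<noteq> 0"
    then have "\<beta> = (- a) / b" using assms(3) by (simp add: field_simps)
    then show False using assms(1,2) beta_irrational by (metis Rats_divide Rats_minus_iff)
  qed
  then show "a = 0" using assms(3) by simp
qed

lemma degree_annihilator:
  assumes "g \<noteq> 0" "poly (map_poly of_rat g) \<beta> = 0"
  shows "2 \<le> degree g"
proof (rule ccontr)
  assume "\<not> 2 \<le> degree g"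
  then have g: "g = [:coeff g 0, coeff g 1:]"
    by (intro poly_eqI) (auto simp: coeff_pCons coeff_eq_0 split: nat.split)
  have "poly (map_poly of_rat [:coeff g 0, coeff g 1:]) \<beta> = 0"
    using assms(2) g by metis
  then have "of_rat (coeff g 0) + of_rat (coeff g 1) * \<beta> = 0"
    by (simp add: map_poly_pCons mult.commute)
  from affine_zero[OF _ _ this] have "coeff g 0 = 0" "coeff g 1 = 0"
    by auto
  then show False using g assms(1) by simp
qed

lemma annihilator: "poly (map_poly of_rat [:of_int e, - of_int p, 1:]) \<beta> = 0"
  using square_beta by (simp add: map_poly_pCons algebra_simps power2_eq_square of_rat_minus)

lemma is_min_poly_iff: "is_min_poly f \<beta> \<longleftrightarrow> f = [:of_int e, - of_int p, 1:]"
proof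
  assume f: "is_min_poly f \<beta>"
  then have lc: "lead_coeff f = 1" and z: "poly (map_poly of_rat f) \<beta> = 0"
    by (auto simp: is_min_poly_def)
  have "degree f \<le> degree [:of_int e, - of_int p, 1 :: rat:]"
    using f annihilator unfolding is_min_poly_def by (metis pCons_eq_0_iff zero_neq_one)
  moreover have "2 \<le> degree f"
    using lc z by (intro degree_annihilator) auto
  ultimately have deg: "degree f = 2" by simp
  with lc have f_eq: "f = [:coeff f 0, coeff f 1, 1:]"
    by (intro poly_eqI) (auto simp: coeff_pCons coeff_eq_0 numeral_2_eq_2 split: nat.split)
  have "poly (map_poly of_rat [:coeff f 0, coeff f 1, 1:]) \<beta> = 0"
    using z f_eq by metis
  then have "of_rat (coeff f 0) + of_rat (coeff f 1) * \<beta> + \<beta>\<^sup>2 = 0"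
    by (simp add: map_poly_pCons algebra_simps power2_eq_square)
  then have "of_rat (coeff f 0 - of_int e) + of_rat (coeff f 1 + of_int p) * \<beta> = 0"
    unfolding square_beta by (simp add: of_rat_diff of_rat_add algebra_simps)
  from affine_zero[OF _ _ this] have "coeff f 0 = of_int e" "coeff f 1 = - of_int p"
    by (auto simp: eq_neg_iff_add_eq_0)
  then show "f = [:of_int e, - of_int p, 1:]" using f_eq by metis
next
  assume f: "f = [:of_int e, - of_int p, 1:]"
  then show "is_min_poly f \<beta>"
    using degree_annihilator annihilator by (auto simp: is_min_poly_def numeral_2_eq_2)
qed

lemma conj_root_eq: "conj_root \<beta> = \<gamma>"
proof -
  have "poly (map_poly of_rat [:of_int e, - of_int p, 1:]) y = (y - \<beta>) * (y - \<gamma>)" for y :: real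
    by (simp add: map_poly_pCons algebra_simps of_rat_minus flip: trace norm)
  moreover have "\<gamma> \<noteq> \<beta>" using abs_gamma gt_1 by auto
  ultimately show ?thesis
    unfolding conj_root_def is_min_poly_iff by (intro the_equality) auto
qed

text \<open>The graph of the conjugation \<open>\<int>[\<beta>] \<rightarrow> \<int>[\<beta>]\<close>, as a relation: closure under the ring operations
  can then be read off without first knowing that coordinates in the basis \<open>1, \<beta>\<close> are unique.\<close>

definition conjugates :: "real \<Rightarrow> real \<Rightarrow> bool" where
  "conjugates x x' \<longleftrightarrow> (\<exists>a b :: int. x = of_int a + of_int b * \<beta> \<and> x' = of_int a + of_int b * \<gamma>)"

lemma galois_conj_eq:
  assumes "conjugates x x'"
  shows "galois_conj \<beta> x = x'"
proof -
  obtain a b :: int where ab: "x = of_int a + of_int b * \<beta>" "x' = of_int a + of_int b * \<gamma>"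
    using assms by (auto simp: conjugates_def)
  have unique: "c = a \<and> d = b" if "x = of_int c + of_int d * \<beta>" for c d :: int
  proof -
    have "of_int (c - a) + of_int (d - b) * \<beta> = 0"
      using that ab by (simp add: algebra_simps)
    from affine_zero[OF _ _ this] show ?thesis by auto
  qed
  show ?thesis
    unfolding galois_conj_def conj_root_eq
  proof (rule the_equality)
    show "\<exists>a b. x = of_int a + of_int b * \<beta> \<and> x' = of_int a + of_int b * \<gamma>"
      using ab by blast
    show "z = x'" if "\<exists>a b. x = of_int a + of_int b * \<beta> \<and> z = of_int a + of_int b * \<gamma>" for z
      using that unique ab(2) by blast
  qed
qed

lemma cut_and_project_iff:
  assumes "conjugates x x'"
  shows "x \<in> cut_and_project \<beta> \<Omega> \<longleftrightarrow> x' \<in> \<Omega>"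
  using assms galois_conj_eq[OF assms]
  by (auto simp: cut_and_project_def Z_adjoin_def conjugates_def)

lemma conjugates_of_int: "conjugates (of_int a) (of_int a)"
  unfolding conjugates_def by (rule exI[of _ a], rule exI[of _ 0]) simp

lemma conjugates_of_nat: "conjugates (of_nat a) (of_nat a)"
  using conjugates_of_int[of "int a"] by simp

lemma conjugates_beta: "conjugates \<beta> \<gamma>"
  unfolding conjugates_def by (rule exI[of _ 0], rule exI[of _ 1]) simp

lemma conjugates_add:
  assumes "conjugates x x'" "conjugates y y'"
  shows "conjugates (x + y) (x' + y')"
proof -
  obtain a b c d :: int where
    "x = of_int a + of_int b * \<beta>" "x' = of_int a + of_int b * \<gamma>"
    "y = of_int c + of_int d * \<beta>" "y' = of_int c + of_int d * \<gamma>"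
    using assms by (auto simp: conjugates_def)
  then show ?thesis
    unfolding conjugates_def
    by (intro exI[of _ "a + c"] exI[of _ "b + d"]) (simp add: algebra_simps)
qed

lemma conjugates_mult:
  assumes "conjugates x x'" "conjugates y y'"
  shows "conjugates (x * y) (x' * y')"
proof -
  obtain a b c d :: int where xy:
    "x = of_int a + of_int b * \<beta>" "x' = of_int a + of_int b * \<gamma>"
    "y = of_int c + of_int d * \<beta>" "y' = of_int c + of_int d * \<gamma>"
    using assms by (auto simp: conjugates_def)
  have "(of_int a + of_int b * z) * (of_int c + of_int d * z)
      = of_int (a * c - b * d * e) + of_int (a * d + b * c + b * d * p) * z"
    if "z\<^sup>2 = of_int p * z - of_int e" for z :: real
  proof -
    have "(of_int a + of_int b * z) * (of_int c + of_int d * z)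
        = of_int (a * c) + of_int (a * d + b * c) * z + of_int (b * d) * z\<^sup>2"
      by (simp add: algebra_simps power2_eq_square)
    also have "\<dots> = of_int (a * c - b * d * e) + of_int (a * d + b * c + b * d * p) * z"
      unfolding that by (simp add: algebra_simps)
    finally show ?thesis .
  qed
  note expand = this
  show ?thesis
    unfolding conjugates_def
  proof (intro exI conjI)
    show "x * y = of_int (a * c - b * d * e) + of_int (a * d + b * c + b * d * p) * \<beta>"
      unfolding xy(1,3) by (rule expand[OF square_beta])
    show "x' * y' = of_int (a * c - b * d * e) + of_int (a * d + b * c + b * d * p) * \<gamma>"
      unfolding xy(2,4) by (rule expand[OF square_gamma])
  qed
qed

lemma conjugates_power: "conjugates x x' \<Longrightarrow> conjugates (x ^ n) (x' ^ n)"
proof (induction n)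
  case 0
  show ?case using conjugates_of_int[of 1] by simp
next
  case (Suc n)
  then have "conjugates (x * x ^ n) (x' * x' ^ n)"
    by (intro conjugates_mult)
  then show ?case by simp
qed

lemma conjugates_sum:
  "(\<And>i. i \<in> A \<Longrightarrow> conjugates (f i) (f' i)) \<Longrightarrow> conjugates (sum f A) (sum f' A)"
proof (induction A rule: infinite_finite_induct)
  case (insert x A)
  then have "conjugates (f x + sum f A) (f' x + sum f' A)"
    by (intro conjugates_add) auto
  then show ?case using insert.hyps by simp
qed (use conjugates_of_int[of 0] in simp_all)

end

section \<open>Forced digits\<close>

text \<open>Both partial sums are governed by the same constant \<open>s\<close>, because \<open>s r = s + m\<close>.\<close>

lemma sum_geometric_pow:
  fixes m r s :: real
  assumes "1 < r" and s: "s = m / (r - 1)"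
  shows "(\<Sum>i\<le>n. m * r ^ i) = r ^ n * (s + m) - s"
    and "(\<Sum>i\<le>n. m * (1 / r) ^ i) = (s + m) - s * (1 / r) ^ n"
proof -
  have sr: "s * r = s + m" using assms by (simp add: field_simps)
  show "(\<Sum>i\<le>n. m * r ^ i) = r ^ n * (s + m) - s"
  proof (induction n)
    case (Suc n)
    have "(\<Sum>i\<le>Suc n. m * r ^ i) = r ^ n * (s + m) - s + m * r ^ Suc n"
      by (simp only: sum.atMost_Suc Suc.IH)
    also have "r ^ n * (s + m) = r ^ Suc n * s"
      by (simp flip: sr)
    also have "r ^ Suc n * s - s + m * r ^ Suc n = r ^ Suc n * (s + m) - s"
      by (simp add: distrib_left)
    finally show ?case .
  qed simp
  have sr': "s = (s + m) * (1 / r)" using sr assms(1) by (simp add: field_simps)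
  show "(\<Sum>i\<le>n. m * (1 / r) ^ i) = (s + m) - s * (1 / r) ^ n"
  proof (induction n)
    case (Suc n)
    have "(\<Sum>i\<le>Suc n. m * (1 / r) ^ i) = (s + m) - s * (1 / r) ^ n + m * (1 / r) ^ Suc n"
      by (simp only: sum.atMost_Suc Suc.IH)
    also have "s * (1 / r) ^ n = (s + m) * (1 / r) ^ Suc n"
      by (subst sr') simp
    also have "(s + m) - (s + m) * (1 / r) ^ Suc n + m * (1 / r) ^ Suc n
        = (s + m) - s * (1 / r) ^ Suc n"
      by (simp add: distrib_right del: power_Suc)
    finally show ?case .
  qed simp
qed

text \<open>The supremum \<open>s + m\<close> of all expansions in base \<open>1 / r\<close> is not attained by a finite one. Lowering
  the digit at position \<open>i \<le> n\<close> costs at least \<open>r\<^sup>-\<^sup>i \<ge> r\<^sup>-\<^sup>n\<close>, so the value would drop strictly below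
  \<open>s + m - r\<^sup>-\<^sup>n\<close>.\<close>

lemma forced_digits:
  fixes r s :: real and b :: "nat \<Rightarrow> nat"
  assumes r: "1 < r" and s: "s = real m / (r - 1)" and m: "0 < m"
    and digits: "\<And>i. b i \<le> m" and fin: "\<And>i. M < i \<Longrightarrow> b i = 0"
    and near: "s + real m - (1 / r) ^ n \<le> (\<Sum>i\<le>M. real (b i) * (1 / r) ^ i)"
    and i: "i \<le> n"
  shows "b i = m"
proof (rule ccontr)
  assume "b i \<noteq> m"
  with digits[of i] have bi: "real (b i) \<le> real m - 1" by linarith
  define K where "K = max M n"
  have "(\<Sum>j\<le>M. real (b j) * (1 / r) ^ j) = (\<Sum>j\<le>K. real (b j) * (1 / r) ^ j)"
    using fin by (intro sum.mono_neutral_left) (auto simp: K_def)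
  also have "\<dots> \<le> (\<Sum>j\<le>K. real m * (1 / r) ^ j - (if j = i then (1 / r) ^ j else 0))"
  proof (rule sum_mono)
    fix j
    have "real (b j) * (1 / r) ^ j \<le> (real m - (if j = i then 1 else 0)) * (1 / r) ^ j"
      using r bi digits[of j] by (intro mult_right_mono) auto
    then show "real (b j) * (1 / r) ^ j
        \<le> real m * (1 / r) ^ j - (if j = i then (1 / r) ^ j else 0)"
      by (auto simp: algebra_simps)
  qed
  also have "\<dots> = (\<Sum>j\<le>K. real m * (1 / r) ^ j) - (1 / r) ^ i"
    using i by (simp add: sum_subtractf K_def)
  also have "\<dots> = s + real m - s * (1 / r) ^ K - (1 / r) ^ i"
    by (simp add: sum_geometric_pow(2)[OF r s])
  also have "\<dots> < s + real m - (1 / r) ^ i"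
    using r m s by simp
  also have "\<dots> \<le> s + real m - (1 / r) ^ n"
    using r i by (simp add: power_decreasing)
  finally show False using near by simp
qed

text \<open>Dropping the digits at positions not divisible by \<open>d\<close> does not decrease the conjugate and does
  not increase the number itself, so the digits at multiples of \<open>d\<close> still reach the forcing
  threshold and already account for the lower bound.\<close>

lemma digit_spectrum_ge:
  fixes \<beta> \<gamma> r s :: real and a :: "nat \<Rightarrow> nat"
  assumes beta: "1 < \<beta>" and d: "0 < d" and r: "r = \<beta> ^ d"
    and gamma_pow: "\<gamma> ^ d = 1 / r" and gamma_neg: "\<And>j. \<not> d dvd j \<Longrightarrow> \<gamma> ^ j \<le> 0"
    and s: "s = real m / (r - 1)" and m: "0 < m"
    and digits: "\<And>j. j \<le> N \<Longrightarrow> a j \<le> m"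
    and near: "s + real m - (1 / r) ^ n \<le> (\<Sum>j\<le>N. real (a j) * \<gamma> ^ j)"
  shows "r ^ n * (s + real m) - s \<le> (\<Sum>j\<le>N. real (a j) * \<beta> ^ j)"
proof -
  have r1: "1 < r" using beta d by (simp add: r)
  define b where "b j = (if j \<le> N then a j else 0)" for j
  define K where "K = max N n"
  have "1 * K \<le> d * K" using d by (intro mult_le_mono1) simp
  then have N_le: "N \<le> d * K" by (simp add: K_def)
  \<comment> \<open>sums over all digits, extended by zeros up to the common length \<open>d * K\<close>\<close>
  have extend: "(\<Sum>j\<le>N. real (a j) * z ^ j) = (\<Sum>j\<le>d * K. real (b j) * z ^ j)" for z :: real
    using N_le by (intro sum.mono_neutral_cong_left) (auto simp: b_def)
  have multiples: "(\<Sum>j\<in>(*) d ` {..K}. real (b j) * z ^ j)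
      = (\<Sum>i\<le>K. real (b (d * i)) * (z ^ d) ^ i)" for z :: real
    using d by (subst sum.reindex) (auto simp: inj_on_def power_mult)
  have sub: "(*) d ` {..K} \<subseteq> {..d * K}" by auto
  have rest: "\<not> d dvd j" if "j \<in> {..d * K} - (*) d ` {..K}" for j
    using that d by (auto elim!: dvdE)
  have "(\<Sum>j\<le>N. real (a j) * \<gamma> ^ j) = (\<Sum>j\<le>d * K. real (b j) * \<gamma> ^ j)"
    by (rule extend)
  also have "\<dots> = (\<Sum>j\<in>{..d * K} - (*) d ` {..K}. real (b j) * \<gamma> ^ j)
      + (\<Sum>j\<in>(*) d ` {..K}. real (b j) * \<gamma> ^ j)"
    by (rule sum.subset_diff[OF sub]) simp
  also have "\<dots> \<le> (\<Sum>j\<in>(*) d ` {..K}. real (b j) * \<gamma> ^ j)"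
    using sum_nonpos[of "{..d * K} - (*) d ` {..K}" "\<lambda>j. real (b j) * \<gamma> ^ j"]
      rest gamma_neg by (simp add: mult_nonneg_nonpos)
  finally have "s + real m - (1 / r) ^ n \<le> (\<Sum>i\<le>K. real (b (d * i)) * (1 / r) ^ i)"
    using near by (simp add: multiples gamma_pow)
  moreover have "b (d * i) = 0" if "K < i" for i
  proof -
    have "d * K < d * i" using that d by simp
    with N_le have "N < d * i" by (rule le_less_trans)
    then show ?thesis by (simp add: b_def)
  qed
  ultimately have forced: "b (d * i) = m" if "i \<le> n" for i
    using r1 s m digits that by (intro forced_digits[of r s m "\<lambda>i. b (d * i)" K n]) (auto simp: b_def)
  have "r ^ n * (s + real m) - s = (\<Sum>i\<le>n. real (b (d * i)) * r ^ i)"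
    by (simp add: forced flip: sum_geometric_pow(1)[OF r1 s])
  also have "\<dots> \<le> (\<Sum>i\<le>K. real (b (d * i)) * r ^ i)"
    using r1 by (intro sum_mono2) (auto simp: K_def)
  also have "\<dots> \<le> (\<Sum>j\<le>d * K. real (b j) * \<beta> ^ j)"
    unfolding r multiples[symmetric] using beta sub by (intro sum_mono2) auto
  finally show ?thesis by (simp add: extend)
qed

section \<open>Points of the window outside the spectrum\<close>

lemma infinite_if_eventually_in:
  fixes c k r :: real
  assumes "1 < r" "0 < c" and "\<And>n. k < c * r ^ n \<Longrightarrow> c * r ^ n - k \<in> A"
  shows "infinite A"
proof -
  obtain N where N: "k / c < r ^ N" using real_arch_pow[OF assms(1)] by blast
  have "k < c * r ^ n" if "N \<le> n" for n
  proof -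
    have "r ^ N \<le> r ^ n" using that assms(1) by (simp add: power_increasing)
    with N have "k / c < r ^ n" by simp
    then show ?thesis using assms(2) by (simp add: field_simps)
  qed
  then have "(\<lambda>n. c * r ^ n - k) ` {N..} \<subseteq> A" using assms(3) by auto
  moreover have "inj_on (\<lambda>n. c * r ^ n - k) {N..}"
    using assms(1,2) by (auto simp: inj_on_def)
  then have "infinite ((\<lambda>n. c * r ^ n - k) ` {N..})"
    using infinite_Ici finite_imageD by blast
  ultimately show ?thesis using infinite_super by blast
qed

context conjugate_units
begin

text \<open>For \<open>v = a - k \<beta>\<close> the half-open window of length 1 for \<open>v'\<close> determines \<open>a\<close> from \<open>k\<close>. Then
  \<open>v = v' - k D\<close> with \<open>D = \<beta> - \<gamma>\<close>, so \<open>s \<le> k D < 2 s + m - 1\<close> puts \<open>v\<close> into the required interval. The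
  least \<open>k\<close> with \<open>s \<le> k D\<close> overshoots \<open>s\<close> by less than \<open>D\<close>, which is harmless if \<open>D < s\<close>;
  if \<open>s \<le> D\<close> then \<open>k = 1\<close> and the hypothesis is exactly what is needed.\<close>

lemma small_point_exists:
  assumes "0 < s" "1 \<le> m" and "1 + (\<beta> - \<gamma>) < 2 * s + m"
  obtains v v' where "conjugates v v'" "s - 1 \<le> v'" "v' < s" "- (s + m) < v" "v < 0"
proof -
  define D where "D = \<beta> - \<gamma>"
  have D: "0 < D" using gt_1 abs_gamma by (auto simp: D_def)
  define k where "k = \<lceil>s / D\<rceil>"
  define a where "a = \<lceil>s + of_int k * \<gamma>\<rceil> - 1"
  define v where "v = of_int a + of_int (- k) * \<beta>"
  define v' where "v' = of_int a + of_int (- k) * \<gamma>"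
  have "s / D \<le> of_int k" "of_int k < s / D + 1"
    unfolding k_def by linarith+
  then have k: "s \<le> of_int k * D" "of_int k * D < s + D"
    using D by (simp_all add: field_simps)
  have v': "s - 1 \<le> v'" "v' < s" unfolding v'_def a_def by simp_all linarith+
  have v: "v = v' - of_int k * D" by (simp add: v_def v'_def D_def algebra_simps)
  have "of_int k * D < 2 * s + m - 1"
  proof (cases "s \<le> D")
    case True
    then have "k = 1" using D assms(1) by (simp add: k_def ceiling_eq_iff)
    then show ?thesis using assms(3) by (simp add: D_def)
  next
    case False
    then show ?thesis using k assms(2) by simp
  qed
  then have "- (s + m) < v" "v < 0" using v v' k by simp_all
  moreover have "conjugates v v'" unfolding conjugates_def v_def v'_def by blast
  ultimately show ?thesis using v' that by blast
qed

lemma infinite_outside_spectrum: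
  fixes s r :: real
  assumes d: "0 < d" and r: "r = \<beta> ^ d"
    and gamma_pow: "\<gamma> ^ d = 1 / r" and gamma_neg: "\<And>j. \<not> d dvd j \<Longrightarrow> \<gamma> ^ j \<le> 0"
    and s: "s = real m / (r - 1)" and m: "0 < m"
    and large: "1 + (\<beta> - \<gamma>) < 2 * s + real m"
    and window: "{0..<s + real m} \<subseteq> \<Omega>"
  shows "infinite {y. 0 < y \<and> y \<in> cut_and_project \<beta> \<Omega> \<and> y \<notin> digit_spectrum m \<beta>}"
proof -
  have r1: "1 < r" using gt_1 d by (simp add: r)
  have s0: "0 < s" using r1 m s by simp
  from s0 m large obtain v v' where v: "conjugates v v'" "s - 1 \<le> v'" "v' < s"
      "- (s + real m) < v" "v < 0"
    by (auto intro: small_point_exists[of s "real m"])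
  have point: "(s + real m + v) * r ^ n - s
      \<in> {y. 0 < y \<and> y \<in> cut_and_project \<beta> \<Omega> \<and> y \<notin> digit_spectrum m \<beta>}"
    if pos: "s < (s + real m + v) * r ^ n" for n
  proof -
    \<comment> \<open>This is \<open>m \<Sum>\<^sub>i\<^sub>\<le>\<^sub>n r\<^sup>i + v r\<^sup>n\<close>, and \<open>y'\<close> is its conjugate.\<close>
    define y where "y = (s + real m + v) * r ^ n - s"
    define y' where "y' = s + real m - (s - v') * (1 / r) ^ n"
    have r_conj: "conjugates r (1 / r)"
      using conjugates_power[OF conjugates_beta, of d] by (simp add: r gamma_pow)
    have "conjugates ((\<Sum>i\<le>n. real m * r ^ i) + v * r ^ n)
        ((\<Sum>i\<le>n. real m * (1 / r) ^ i) + v' * (1 / r) ^ n)"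
      by (intro conjugates_add conjugates_mult conjugates_sum conjugates_of_nat
          conjugates_power r_conj v(1))
    then have conj: "conjugates y y'"
      unfolding sum_geometric_pow[OF r1 s] by (simp add: y_def y'_def algebra_simps)
    have pow: "0 < (1 / r) ^ n" "(1 / r) ^ n \<le> 1" using r1 by (simp_all add: power_le_one)
    have near: "s + real m - (1 / r) ^ n \<le> y'"
      using v pow mult_right_mono[of "s - v'" 1 "(1 / r) ^ n"] by (simp add: y'_def)
    have "0 \<le> y'" using near pow s0 m by linarith
    moreover have "y' < s + real m" using v pow by (simp add: y'_def)
    ultimately have "y' \<in> {0..<s + real m}" by simp
    then have "y \<in> cut_and_project \<beta> \<Omega>"
      using window cut_and_project_iff[OF conj] by blast
    moreover have "y \<notin> digit_spectrum m \<beta>"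
    proof
      assume "y \<in> digit_spectrum m \<beta>"
      then obtain N and a :: "nat \<Rightarrow> nat" where a: "\<And>j. j \<le> N \<Longrightarrow> a j \<le> m"
          and y_sum: "y = (\<Sum>j\<le>N. real (a j) * \<beta> ^ j)"
        by (auto simp: digit_spectrum_def)
      have "conjugates y (\<Sum>j\<le>N. real (a j) * \<gamma> ^ j)"
        unfolding y_sum
        by (intro conjugates_sum conjugates_mult conjugates_of_nat conjugates_power conjugates_beta)
      then have "y' = (\<Sum>j\<le>N. real (a j) * \<gamma> ^ j)"
        using galois_conj_eq conj by metis
      with near have "r ^ n * (s + real m) - s \<le> (\<Sum>j\<le>N. real (a j) * \<beta> ^ j)"
        by (intro digit_spectrum_ge[OF gt_1 d r gamma_pow gamma_neg s m a]) auto
      then have "r ^ n * (s + real m) - s \<le> y" by (simp add: y_sum)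
      moreover have "v * r ^ n < 0" using v r1 by (simp add: mult_neg_pos)
      ultimately show False by (simp add: y_def algebra_simps)
    qed
    ultimately show ?thesis using pos by (simp add: y_def)
  qed
  show ?thesis
    using r1 v(4) point by (intro infinite_if_eventually_in[of r "s + real m + v" s]) auto
qed

end

section \<open>The two families of quadratic units\<close>

theorem proposition7:
  fixes \<beta> :: real and m :: nat and \<Omega> :: "real set"
  assumes "quadratic_unit \<beta>"
    and "\<lfloor>\<beta>\<rfloor> \<le> int m"
    and "\<And>p :: int. p \<ge> 1 \<Longrightarrow> \<beta>\<^sup>2 = of_int p * \<beta> + 1 \<Longrightarrow>
           \<Omega> = {- (real m * \<beta> / (\<beta>\<^sup>2 - 1)) <..< real m * \<beta>\<^sup>2 / (\<beta>\<^sup>2 - 1)}"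
    and "\<And>p :: int. p \<ge> 3 \<Longrightarrow> \<beta>\<^sup>2 = of_int p * \<beta> - 1 \<Longrightarrow>
           \<Omega> = {0 ..< real m * \<beta> / (\<beta> - 1)}"
    and "\<not> (int m = \<lfloor>\<beta>\<rfloor> \<and> (\<exists>p :: int. p \<ge> 1 \<and> \<beta>\<^sup>2 = of_int p * \<beta> + 1))"
  shows "infinite {y. 0 < y \<and> y \<in> cut_and_project \<beta> \<Omega> \<and> y \<notin> digit_spectrum m \<beta>}"
proof -
  have beta: "1 < \<beta>" using assms(1) by (simp add: quadratic_unit_def)
  have sq: "1 < \<beta>\<^sup>2" using beta by simp
  have m: "0 < m" using beta assms(2) by linarith
  from assms(1) consider
      (minus) p where "1 \<le> p" "is_larger_root [:-1, -p, 1:] \<beta>"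
    | (plus) p where "3 \<le> p" "is_larger_root [:1, -p, 1:] \<beta>"
    by (auto simp: quadratic_unit_def)
  then show ?thesis
  proof cases
    case (minus p)
    then have eq: "\<beta>\<^sup>2 = of_int p * \<beta> + 1"
      by (simp add: is_larger_root_def map_poly_pCons algebra_simps power2_eq_square)
    define t where "t = 1 / \<beta>"
    have t: "0 < t" "t < 1" "\<beta> * t = 1" using beta by (auto simp: t_def)
    have beta_eq: "\<beta> = of_int p + t"
      using eq beta by (simp add: t_def field_simps power2_eq_square)
    then have "\<lfloor>\<beta>\<rfloor> = p" using t by (simp add: floor_eq_iff)
    moreover have "int m \<noteq> \<lfloor>\<beta>\<rfloor>" using assms(5) eq minus(1) by blast
    ultimately have "p + 1 \<le> int m" using assms(2) by linarith
    \<comment> \<open>With \<open>\<beta> - \<beta>' = \<beta> + t = p + 2 t\<close> the inequality to reach is \<open>p + 1 + 2 t < 2 s + m\<close>, and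
      \<open>s = t m / p > t\<close> because \<open>m > p\<close>.\<close>
    then have mp: "of_int p + 1 \<le> real m" by linarith
    define s where "s = real m / (\<beta>\<^sup>2 - 1)"
    have "s = t * (real m / of_int p)"
      using eq beta minus(1) by (simp add: s_def t_def)
    also have "\<dots> > t * 1"
      using t mp minus(1) by (intro mult_strict_left_mono) (auto simp: field_simps)
    finally have s: "t < s" by simp
    interpret conjugate_units \<beta> "- t" p "-1"
      using beta t beta_eq by unfold_locales auto
    have "{0..<s + real m} \<subseteq> {- (real m * \<beta> / (\<beta>\<^sup>2 - 1)) <..< real m * \<beta>\<^sup>2 / (\<beta>\<^sup>2 - 1)}"
    proof -
      have "0 < real m * \<beta> / (\<beta>\<^sup>2 - 1)" using beta sq m by simp
      moreover have "s + real m = real m * \<beta>\<^sup>2 / (\<beta>\<^sup>2 - 1)"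
        using sq by (simp add: s_def field_simps)
      ultimately show ?thesis by auto
    qed
    also have "\<dots> = \<Omega>" using assms(3) minus(1) eq by simp
    finally have "{0..<s + real m} \<subseteq> \<Omega>" .
    moreover have "(- t) ^ j \<le> 0" if "\<not> 2 dvd j" for j
      using that t by simp
    moreover have "(- t)\<^sup>2 = 1 / \<beta>\<^sup>2"
      by (simp add: t_def power_divide)
    moreover have "1 + (\<beta> - - t) < 2 * s + real m"
      using s mp beta_eq by linarith
    ultimately show ?thesis
      by (intro infinite_outside_spectrum[OF _ refl _ _ s_def m]) (assumption | simp only: pos2)+
  next
    case (plus p)
    then have eq: "\<beta>\<^sup>2 = of_int p * \<beta> - 1"
      by (simp add: is_larger_root_def map_poly_pCons algebra_simps power2_eq_square)
    define t where "t = 1 / \<beta>"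
    have t: "0 < t" "\<beta> * t = 1" using beta by (auto simp: t_def)
    have beta_eq: "\<beta> + t = of_int p"
      using eq beta by (simp add: t_def field_simps power2_eq_square)
    define s where "s = real m / (\<beta> - 1)"
    \<comment> \<open>Here \<open>2 s + m > 2 + (\<beta> - 1) > 1 + (\<beta> - t)\<close>.\<close>
    have mb: "\<beta> - 1 < real m" using assms(2) by linarith
    then have s: "1 < s" using beta by (simp add: s_def)
    interpret conjugate_units \<beta> t p 1
      using beta t beta_eq by unfold_locales auto
    have "s + real m = real m * \<beta> / (\<beta> - 1)"
      using beta by (simp add: s_def field_simps)
    then have "{0..<s + real m} \<subseteq> \<Omega>" using assms(4) plus(1) eq by simp
    moreover have "1 + (\<beta> - t) < 2 * s + real m"
      using s mb t by linarith
    moreover have "t ^ 1 = 1 / \<beta>" by (simp add: t_def)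
    moreover have "t ^ j \<le> 0" if "\<not> 1 dvd j" for j :: nat
      using that by simp
    ultimately show ?thesis
      by (intro infinite_outside_spectrum[OF zero_less_one power_one_right[symmetric] _ _ s_def m])
  qed
qed

end
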